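(* Let $\varphi$ be a random variable with probability distribution $\mu$ supported in $[0,1)$ (that is, $\varphi\in[0,1)$ almost surely), let $u_k=\mathbb{E}[\varphi^k]$ for $k\ge 1$, and let $m(r)=\sum_{k\ge 1}u_k r^k$ for $r\in[0,1)$. Let $\{a_k,\ k\ge 1\}$ be the sequence of real numbers defined by $a_k=\mathbb{E}[A_k]$, where $A_1=\varphi$ and $A_{k+1}=(A_k-a_k)\varphi$ for $k\ge 1$. Then the series $\sum_{k=1}^{\infty}a_k$ is convergent and $$\sum_{k=1}^{+\infty}a_k=\lim_{r\to 1^-}\frac{m(r)}{1+m(r)}.$$
   Context: Equivalently, the $a_k$ are given by $a_1=u_1$ and $a_{k+1}=u_{k+1}-\sum_{r=1}^{k}a_r u_{k-r+1}$ for $k\ge 1$. Convergence of $\sum a_k$ means convergence of the partial sums (not necessarily absolute convergence). *)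

theory Defs
  imports "HOL-Probability.Probability"
begin

end

theory Submission
  imports Defs
begin

text \<open>
  With \<open>u\<^sub>0 = 1\<close>, the \<open>a\<^sub>k\<close> solve the renewal equation \<open>u\<^sub>n = (\<Sum>k=1..n. a\<^sub>k u\<^bsub>n-k\<^esub>)\<close>. Moment sequences
  are log-convex, so Kaluza's theorem gives \<open>a\<^sub>k \<ge> 0\<close>; since \<open>u\<close> is also decreasing, the renewal
  equation bounds every partial sum of the \<open>a\<^sub>k\<close> by 1. Hence the series converges absolutely, its
  power series is continuous on \<open>[0,1]\<close>, and for \<open>r < 1\<close> it equals \<open>m(r) / (1 + m(r))\<close> by the Cauchy
  product.
\<close>

section \<open>Log-convex sequences and the renewal equation\<close>

text \<open>The ratios \<open>u (Suc n) / u n\<close> increase, written with cross-multiplied terms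
  so that zeros of \<open>u\<close> are allowed. The induction step multiplies by
  \<open>u (Suc n)\<close> and cancels it again.\<close>

lemma log_convex_ratio_mono:
  fixes u :: "nat \<Rightarrow> real"
  assumes nonneg: "\<And>n. 0 \<le> u n"
    and log_convex: "\<And>n. (u (Suc n))\<^sup>2 \<le> u n * u (Suc (Suc n))"
    and "k \<le> n"
  shows "u (Suc k) * u n \<le> u (Suc n) * u k"
  using \<open>k \<le> n\<close>
proof (induction rule: dec_induct)
  case base
  show ?case by simp
next
  case (step n)
  show ?case
  proof (cases "u (Suc n) = 0")
    case True
    then show ?thesis using nonneg by simp
  next
    case False
    with nonneg have pos: "u (Suc n) > 0"
      by (simp add: order_less_le)
    have "u (Suc k) * u (Suc n) * u (Suc n) \<le> u (Suc k) * (u n * u (Suc (Suc n)))"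
      using mult_left_mono[OF log_convex[of n] nonneg[of "Suc k"]]
      by (simp add: power2_eq_square mult_ac)
    also have "\<dots> \<le> u (Suc (Suc n)) * u k * u (Suc n)"
      using mult_right_mono[OF step.IH nonneg[of "Suc (Suc n)"]] by (simp add: mult_ac)
    finally show ?thesis using pos by simp
  qed
qed

text \<open>A zero spreads both ways: a product bounding a square vanishes with either factor. Index
  0 escapes, since \<open>u 0\<close> is never the squared middle term.\<close>

lemma log_convex_zero:
  fixes u :: "nat \<Rightarrow> real"
  assumes log_convex: "\<And>n. (u (Suc n))\<^sup>2 \<le> u n * u (Suc (Suc n))"
    and "u (Suc n) = 0"
  shows "u (Suc k) = 0"
proof -
  have "u (Suc (Suc i)) = 0 \<longleftrightarrow> u (Suc i) = 0" for i
    using log_convex[of i] log_convex[of "Suc i"] by auto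
  then have "u (Suc i) = 0 \<longleftrightarrow> u 1 = 0" for i
    by (induction i) auto
  with \<open>u (Suc n) = 0\<close> show ?thesis by blast
qed

text \<open>Strong induction comparing two consecutive renewal equations. As the ratios of
  \<open>u\<close> increase, passing from index \<open>Suc j\<close> to \<open>Suc (Suc j)\<close>
  scales each earlier term \<open>a i * u (Suc j - i)\<close> by at most
  \<open>u (Suc (Suc j)) / u (Suc j)\<close>, so these terms sum to at most
  \<open>u (Suc (Suc j))\<close>; what remains for the new coefficient is nonnegative.\<close>

theorem Kaluza:
  fixes u a :: "nat \<Rightarrow> real"
  assumes nonneg: "\<And>n. 0 \<le> u n" and u0: "u 0 = 1"
    and log_convex: "\<And>n. (u (Suc n))\<^sup>2 \<le> u n * u (Suc (Suc n))"
    and a0: "a 0 = 0"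
    and renewal: "\<And>n. (\<Sum>i\<le>Suc n. a i * u (Suc n - i)) = u (Suc n)"
  shows "0 \<le> a n"
proof (induction n rule: less_induct)
  case (less n)
  have last: "a (Suc j) = u (Suc j) - (\<Sum>i\<le>j. a i * u (Suc j - i))" for j
    using renewal[of j] u0 by simp
  consider "n = 0" | "n = 1" | j where "n = Suc (Suc j)"
    by (metis One_nat_def not0_implies_Suc)
  then show ?case
  proof cases
    case 1
    then show ?thesis by (simp add: a0)
  next
    case 2
    then show ?thesis using last[of 0] a0 nonneg by simp
  next
    case (3 j)
    show ?thesis
    proof (cases "u (Suc j) = 0")
      case True
      have "u (Suc k) = 0" for k
        using log_convex True by (rule log_convex_zero)
      \<comment> \<open>Every index \<open>Suc (Suc j) - i\<close> in this range is
        positive.\<close>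
      then have "(\<Sum>i\<le>Suc j. a i * u (Suc (Suc j) - i)) = 0"
        by (intro sum.neutral) (auto simp: Suc_diff_le simp del: diff_Suc_Suc)
      then show ?thesis
        using last[of "Suc j"] nonneg 3 by simp
    next
      case False
      with nonneg have pos: "u (Suc j) > 0"
        by (simp add: order_less_le)
      have "u (Suc j) * (\<Sum>i\<le>Suc j. a i * u (Suc (Suc j) - i))
          = (\<Sum>i\<le>Suc j. a i * (u (Suc (Suc j) - i) * u (Suc j)))"
        by (simp only: sum_distrib_left mult_ac)
      also have "\<dots> \<le> (\<Sum>i\<le>Suc j. a i * (u (Suc (Suc j)) * u (Suc j - i)))"
      proof (intro sum_mono)
        fix i assume i: "i \<in> {..Suc j}"
        show "a i * (u (Suc (Suc j) - i) * u (Suc j)) \<le> a i * (u (Suc (Suc j)) * u (Suc j - i))"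
          using log_convex_ratio_mono[where u = u, OF nonneg log_convex, of "Suc j - i" "Suc j"] less.IH[of i] i 3
          by (intro mult_left_mono) (auto simp: Suc_diff_le simp del: diff_Suc_Suc)
      qed
      also have "\<dots> = u (Suc (Suc j)) * (\<Sum>i\<le>Suc j. a i * u (Suc j - i))"
        by (simp only: sum_distrib_left mult_ac)
      also have "\<dots> = u (Suc j) * u (Suc (Suc j))"
        by (simp only: renewal mult.commute)
      finally show ?thesis
        using pos last[of "Suc j"] 3 by simp
    qed
  qed
qed

text \<open>Since \<open>u\<close> decreases, replacing each \<open>u (Suc j - i)\<close> in the
  renewal equation by \<open>u (Suc j)\<close> only lowers the left side; then
  \<open>u (Suc j)\<close> cancels.\<close>

lemma renewal_partial_sum_le_1:
  fixes u a :: "nat \<Rightarrow> real"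
  assumes nonneg: "\<And>n. 0 \<le> u n" and u0: "u 0 = 1" and "antimono u"
    and log_convex: "\<And>n. (u (Suc n))\<^sup>2 \<le> u n * u (Suc (Suc n))"
    and a0: "a 0 = 0"
    and renewal: "\<And>n. (\<Sum>i\<le>Suc n. a i * u (Suc n - i)) = u (Suc n)"
  shows "(\<Sum>i\<le>n. a i) \<le> 1"
proof (cases n)
  case 0
  then show ?thesis by (simp add: a0)
next
  case (Suc j)
  have a_nonneg: "0 \<le> a i" for i
    by (rule Kaluza[where u = u, OF nonneg u0 log_convex a0 renewal])
  show ?thesis
  proof (cases "u (Suc j) = 0")
    case True
    \<comment> \<open>Here \<open>u\<close> vanishes at all positive indices, and the last term of
      the renewal sum is \<open>a (Suc k) * u 0\<close>.\<close>
    have "a (Suc k) \<le> 0" for k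
    proof -
      have "u (Suc k) = 0"
        using log_convex True by (rule log_convex_zero)
      moreover have "a (Suc k) * u (Suc k - Suc k) \<le> (\<Sum>i\<le>Suc k. a i * u (Suc k - i))"
        by (rule member_le_sum) (auto simp: nonneg a_nonneg)
      ultimately show ?thesis
        using renewal[of k] u0 by simp
    qed
    then have "a k \<le> 0" for k
      by (cases k) (auto simp: a0)
    then have "(\<Sum>i\<le>n. a i) \<le> 0"
      by (intro sum_nonpos)
    then show ?thesis by simp
  next
    case False
    with nonneg have pos: "u (Suc j) > 0"
      by (simp add: order_less_le)
    have "(\<Sum>i\<le>Suc j. a i) * u (Suc j) = (\<Sum>i\<le>Suc j. a i * u (Suc j))"
      by (rule sum_distrib_right)
    also have "\<dots> \<le> (\<Sum>i\<le>Suc j. a i * u (Suc j - i))"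
      by (intro sum_mono mult_left_mono a_nonneg antimonoD[OF \<open>antimono u\<close>]) simp
    also have "\<dots> = u (Suc j)"
      by (rule renewal)
    finally show ?thesis
      using pos Suc by simp
  qed
qed

section \<open>Power series and their behaviour at 1\<close>

text \<open>The easy case of Abel's theorem: absolute summability makes the convergence uniform on
  the closed interval, endpoint included.\<close>

lemma power_series_tendsto_at_left_1:
  fixes a :: "nat \<Rightarrow> real"
  assumes "summable (\<lambda>n. \<bar>a n\<bar>)"
  shows "((\<lambda>r. \<Sum>n. a n * r ^ n) \<longlongrightarrow> (\<Sum>n. a n)) (at_left 1)"
proof -
  have "uniform_limit {0..1} (\<lambda>n r. \<Sum>i<n. a i * r ^ i) (\<lambda>r. \<Sum>i. a i * r ^ i) sequentially"
    using assms
    by (intro Weierstrass_m_test[where M = "\<lambda>n. \<bar>a n\<bar>"])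
      (auto simp: abs_mult power_le_one intro!: mult_left_le)
  then have "continuous_on {0..1} (\<lambda>r. \<Sum>i. a i * r ^ i)"
    by (rule uniform_limit_theorem[rotated]) (auto intro!: always_eventually continuous_intros)
  then have "((\<lambda>r. \<Sum>n. a n * r ^ n) \<longlongrightarrow> (\<Sum>n. a n * 1 ^ n)) (at 1 within {0..1})"
    unfolding continuous_on_def by (rule bspec) simp
  moreover have "at 1 within {0..1} = at_left (1::real)"
    by (rule at_within_Icc_at_left) simp
  ultimately show ?thesis by simp
qed

lemma renewal_generating_function:
  fixes u a :: "nat \<Rightarrow> real"
  assumes u_bounds: "\<And>n. 0 \<le> u n" "\<And>n. u n \<le> 1" and u0: "u 0 = 1"
    and abs_summable: "summable (\<lambda>n. \<bar>a n\<bar>)" and a0: "a 0 = 0"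
    and renewal: "\<And>n. (\<Sum>i\<le>Suc n. a i * u (Suc n - i)) = u (Suc n)"
    and r: "0 \<le> r" "r < 1"
  defines "m \<equiv> \<Sum>n. u (Suc n) * r ^ Suc n"
  shows "(\<Sum>n. a n * r ^ n) = m / (1 + m)"
proof -
  have su: "summable (\<lambda>n. \<bar>u n * r ^ n\<bar>)"
    using u_bounds r
    by (intro summable_comparison_test'[OF summable_geometric[of r], where N = 0])
      (auto simp: abs_mult intro!: mult_left_le_one_le)
  have sa: "summable (\<lambda>n. \<bar>a n * r ^ n\<bar>)"
    using r
    by (intro summable_comparison_test'[OF abs_summable, where N = 0])
      (auto simp: abs_mult power_le_one intro!: mult_left_le)
  have su': "summable (\<lambda>n. u n * r ^ n)"
    using su by (rule summable_rabs_cancel)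
  have U: "(\<Sum>n. u n * r ^ n) = 1 + m"
    using suminf_split_head[OF su'] u0 by (simp add: m_def)
  \<comment> \<open>Keeps \<open>1 + m\<close> away from 0 for the final division.\<close>
  have m_nonneg: "0 \<le> m"
    unfolding m_def using u_bounds r su'
    by (intro suminf_nonneg) (auto simp: summable_Suc_iff[of "\<lambda>n. u n * r ^ n"] simp del: power_Suc)
  \<comment> \<open>The renewal equation holds only at positive indices; at 0 the product is
    \<open>a 0 * u 0 = 0\<close>, so the Cauchy product loses the constant term of the series of
    \<open>u\<close>.\<close>
  have conv: "(\<Sum>i\<le>n. a i * r ^ i * (u (n - i) * r ^ (n - i))) = (if n = 0 then 0 else u n * r ^ n)" for n
  proof -
    have "(\<Sum>i\<le>n. a i * r ^ i * (u (n - i) * r ^ (n - i))) = (\<Sum>i\<le>n. a i * u (n - i)) * r ^ n"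
      unfolding sum_distrib_right
      by (intro sum.cong refl) (simp add: mult_ac flip: power_add)
    then show ?thesis
      using renewal[of "n - 1"] by (cases n) (auto simp: a0)
  qed
  have "(\<Sum>n. a n * r ^ n) * (\<Sum>n. u n * r ^ n) = (\<Sum>n. if n = 0 then 0 else u n * r ^ n)"
    using Cauchy_product[of "\<lambda>n. a n * r ^ n" "\<lambda>n. u n * r ^ n"] sa su by (simp add: conv)
  also have "\<dots> = m"
  proof -
    have "summable (\<lambda>n. if n = 0 then 0 else u n * r ^ n)"
      using su' by (subst summable_Suc_iff[symmetric]) (simp add: summable_Suc_iff[of "\<lambda>n. u n * r ^ n"] del: power_Suc)
    from suminf_split_head[OF this] show ?thesis
      by (simp add: m_def)
  qed
  finally show ?thesis
    using m_nonneg by (simp add: U field_simps)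
qed

section \<open>Moments of a random variable in the unit interval\<close>

context prob_space
begin

lemma integrable_power_unit_interval:
  fixes X :: "'a \<Rightarrow> real"
  assumes [measurable]: "X \<in> borel_measurable M" and "AE \<omega> in M. X \<omega> \<in> {0..1}"
  shows "integrable M (\<lambda>\<omega>. X \<omega> ^ n)"
proof (rule integrable_const_bound[where B = 1])
  show "AE \<omega> in M. norm (X \<omega> ^ n) \<le> 1"
    using assms(2) by eventually_elim (simp add: power_le_one)
qed simp

lemma moment_antimono:
  fixes X :: "'a \<Rightarrow> real"
  assumes "X \<in> borel_measurable M" and unit: "AE \<omega> in M. X \<omega> \<in> {0..1}"
  shows "antimono (\<lambda>n. expectation (\<lambda>\<omega>. X \<omega> ^ n))"
proof (rule antimonoI)
  fix i j :: nat assume "i \<le> j"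
  show "expectation (\<lambda>\<omega>. X \<omega> ^ j) \<le> expectation (\<lambda>\<omega>. X \<omega> ^ i)"
  proof (intro integral_mono_AE integrable_power_unit_interval[OF assms])
    show "AE \<omega> in M. X \<omega> ^ j \<le> X \<omega> ^ i"
      using unit by eventually_elim (simp add: power_decreasing \<open>i \<le> j\<close>)
  qed
qed

lemma moment_nonneg:
  fixes X :: "'a \<Rightarrow> real"
  assumes "AE \<omega> in M. X \<omega> \<in> {0..1}"
  shows "0 \<le> expectation (\<lambda>\<omega>. X \<omega> ^ n)"
  using assms by (intro integral_nonneg_AE) (auto elim!: eventually_mono)

lemma moment_log_convex:
  fixes X :: "'a \<Rightarrow> real"
  assumes "X \<in> borel_measurable M" and unit: "AE \<omega> in M. X \<omega> \<in> {0..1}"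
  defines "u \<equiv> \<lambda>n. expectation (\<lambda>\<omega>. X \<omega> ^ n)"
  shows "(u (Suc n))\<^sup>2 \<le> u n * u (Suc (Suc n))"
proof (cases "u n = 0")
  case True
  \<comment> \<open>Monotonicity forces the next moment to vanish as well.\<close>
  have "u (Suc n) \<le> u n"
    unfolding u_def by (rule antimonoD[OF moment_antimono[OF assms(1,2)]]) simp
  moreover have "0 \<le> u (Suc n)"
    unfolding u_def by (rule moment_nonneg[OF unit])
  ultimately show ?thesis using True by simp
next
  case False
  have "0 \<le> u n"
    unfolding u_def by (rule moment_nonneg[OF unit])
  with False have pos: "u n > 0" by simp
  note int = integrable_power_unit_interval[OF assms(1,2)]
  \<comment> \<open>The minimiser of the quadratic
    \<open>u (Suc (Suc n)) - 2 * t * u (Suc n) + t\<^sup>2 * u n\<close>, as in the proof of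
    Cauchy-Schwarz.\<close>
  define t where "t = u (Suc n) / u n"
  have "0 \<le> expectation (\<lambda>\<omega>. X \<omega> ^ n * (X \<omega> - t)\<^sup>2)"
    using unit by (intro integral_nonneg_AE) (auto elim!: eventually_mono)
  also have "\<dots> = expectation (\<lambda>\<omega>. X \<omega> ^ Suc (Suc n) - 2 * t * X \<omega> ^ Suc n + t\<^sup>2 * X \<omega> ^ n)"
    by (intro Bochner_Integration.integral_cong refl) (simp add: power2_eq_square algebra_simps)
  also have "\<dots> = u (Suc (Suc n)) - 2 * t * u (Suc n) + t\<^sup>2 * u n"
    unfolding u_def using int by (simp del: power_Suc)
  also have "\<dots> = u (Suc (Suc n)) - (u (Suc n))\<^sup>2 / u n"
    using pos by (simp add: t_def power2_eq_square field_simps)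
  finally show ?thesis
    using pos by (simp add: field_simps)
qed

end

theorem theorem1:
  fixes M :: "'a measure"
    and \<phi> :: "'a \<Rightarrow> real"
    and u :: "nat \<Rightarrow> real"
    and m :: "real \<Rightarrow> real"
    and A :: "nat \<Rightarrow> 'a \<Rightarrow> real"
    and a :: "nat \<Rightarrow> real"
  assumes "prob_space M"
    and "\<phi> \<in> borel_measurable M"
    and "AE \<omega> in M. \<phi> \<omega> \<in> {0..<1}"
    and "\<And>k. k \<ge> 1 \<Longrightarrow> u k = prob_space.expectation M (\<lambda>\<omega>. \<phi> \<omega> ^ k)"
    and "\<And>r. r \<in> {0..<1} \<Longrightarrow> m r = (\<Sum>k. u (Suc k) * r ^ Suc k)"
    and "A 1 = \<phi>"
    and "\<And>k. k \<ge> 1 \<Longrightarrow> A (k + 1) = (\<lambda>\<omega>. (A k \<omega> - a k) * \<phi> \<omega>)"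
    and "\<And>k. k \<ge> 1 \<Longrightarrow> a k = prob_space.expectation M (A k)"
  shows "summable (\<lambda>k. a (Suc k)) \<and>
         ((\<lambda>r. m r / (1 + m r)) \<longlongrightarrow> (\<Sum>k. a (Suc k))) (at_left 1)"
proof -
  interpret prob_space M by fact
  have unit: "AE \<omega> in M. \<phi> \<omega> \<in> {0..1}"
    using assms(3) by eventually_elim simp
  note int = integrable_power_unit_interval[OF assms(2) unit]
  \<comment> \<open>The hypotheses leave \<open>u 0\<close> and \<open>a 0\<close> arbitrary; the renewal equation needs the values 1 and 0.\<close>
  define v where "v n = expectation (\<lambda>\<omega>. \<phi> \<omega> ^ n)" for n
  define b where "b n = (if n = 0 then 0 else a n)" for n
  have v0: "v 0 = 1"
    by (simp add: v_def prob_space)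
  have v_nonneg: "0 \<le> v n" for n
    unfolding v_def by (rule moment_nonneg[OF unit])
  have v_anti: "antimono v"
    unfolding v_def by (rule moment_antimono[OF assms(2) unit])
  have v_le_1: "v n \<le> 1" for n
    using antimonoD[OF v_anti, of 0 n] by (simp add: v0)
  have v_log_convex: "(v (Suc n))\<^sup>2 \<le> v n * v (Suc (Suc n))" for n
    unfolding v_def by (rule moment_log_convex[OF assms(2) unit])
  have b0: "b 0 = 0"
    by (simp add: b_def)

  \<comment> \<open>Unrolling the recursion makes each \<open>A k\<close> a polynomial in
    \<open>\<phi>\<close>, whose expectation is a combination of moments. The term
    \<open>i = 0\<close> vanishes by \<open>b0\<close>.\<close>
  have A_eq: "A (Suc n) = (\<lambda>\<omega>. \<phi> \<omega> ^ Suc n - (\<Sum>i\<le>n. b i * \<phi> \<omega> ^ (Suc n - i)))" for n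
  proof (induction n)
    case 0
    then show ?case using assms(6) by (simp add: b0)
  next
    case (Suc n)
    have "A (Suc (Suc n)) = (\<lambda>\<omega>. (A (Suc n) \<omega> - b (Suc n)) * \<phi> \<omega>)"
      using assms(7)[of "Suc n"] by (simp add: b_def)
    also have "\<dots> = (\<lambda>\<omega>. \<phi> \<omega> ^ Suc (Suc n) - (\<Sum>i\<le>Suc n. b i * \<phi> \<omega> ^ (Suc (Suc n) - i)))"
      by (auto simp: Suc.IH algebra_simps sum_distrib_left Suc_diff_le intro!: ext sum.cong)
    finally show ?case .
  qed
  have renewal: "(\<Sum>i\<le>Suc n. b i * v (Suc n - i)) = v (Suc n)" for n
  proof -
    have "b (Suc n) = expectation (A (Suc n))"
      by (simp add: b_def assms(8))
    also have "\<dots> = v (Suc n) - (\<Sum>i\<le>n. b i * v (Suc n - i))"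
      unfolding A_eq v_def using int by (simp del: power_Suc)
    \<comment> \<open>The term \<open>i = Suc n\<close> of the sum is
      \<open>b (Suc n) * v 0\<close>, with \<open>v 0 = 1\<close>.\<close>
    finally show ?thesis by (simp add: v0)
  qed

  have b_nonneg: "0 \<le> b n" for n
    by (rule Kaluza[where u = v, OF v_nonneg v0 v_log_convex b0 renewal])
  have "summable b"
    using renewal_partial_sum_le_1[where u = v, OF v_nonneg v0 v_anti v_log_convex b0 renewal]
    by (intro bounded_imp_summable[where B = 1] b_nonneg)
  then have b_abs: "summable (\<lambda>n. \<bar>b n\<bar>)"
    using b_nonneg by simp
  have b_Suc: "b (Suc n) = a (Suc n)" for n
    by (simp add: b_def)
  have a_summable: "summable (\<lambda>n. a (Suc n))"
    using \<open>summable b\<close> by (simp add: summable_Suc_iff flip: b_Suc)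
  have sum_b: "(\<Sum>n. b n) = (\<Sum>n. a (Suc n))"
    using suminf_split_head[OF \<open>summable b\<close>] by (simp add: b0 b_Suc)
  have gen: "(\<Sum>n. b n * r ^ n) = m r / (1 + m r)" if "0 < r" "r < 1" for r
    using renewal_generating_function[where u = v, OF v_nonneg v_le_1 v0 b_abs b0 renewal, of r] that
    by (simp add: assms(4,5) v_def)
  have "((\<lambda>r. m r / (1 + m r)) \<longlongrightarrow> (\<Sum>n. b n)) (at_left 1)"
  proof (rule Lim_transform_eventually[OF power_series_tendsto_at_left_1[OF b_abs]])
    show "\<forall>\<^sub>F r in at_left 1. (\<Sum>n. b n * r ^ n) = m r / (1 + m r)"
      \<comment> \<open>The values of \<open>m\<close> are prescribed only on
        \<open>{0..<1}\<close>, but a left neighbourhood of 1 may be taken inside it.\<close>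
      using eventually_at_left_real[of 0 "1::real"] by (auto simp: gen elim!: eventually_mono)
  qed
  then show ?thesis
    using a_summable by (simp add: sum_b)
qed

end
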